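(* Assume that $\alpha\in(\frac12,2]$. Let $(\eta_t)_{t\ge0}$ be the continuous-space birth process on $\mathbb{R}$ with birth rate $b(x,\eta) = 1\wedge \big(\sum_{y\in\eta} a(x-y)\big)$, where $a(z) = c_\alpha (1+|z|^2)^{-\alpha}$, and with initial condition $\eta_0=\{0\}$. Then $(\eta_t)$ grows faster than linearly in the sense that for any $K_0,K_1>0$, $$\mathbb{P}\big\{\eta_t\subset[-K_0-K_1t,\,K_0+K_1t]\ \text{for all sufficiently large } t\big\} = 0.$$
   Context: Let $\Gamma_0 = \{\eta\subset\mathbb{R} : |\eta|<\infty\}$ be the collection of finite subsets of $\mathbb{R}$. For $\alpha>\frac12$ let $c_\alpha>0$ be the constant such that $a(z) = \frac{c_\alpha}{(1+|z|^2)^\alpha}$, $z\in\mathbb{R}$, satisfies $\int_{\mathbb{R}} a(z)\,dz = 1$. The birth rate is $b(x,\eta) = 1\wedge\big(\sum_{y\in\eta} a(x-y)\big)$, $x\in\mathbb{R}$, $\eta\in\Gamma_0$. The birth process $(\eta_t)_{t\ge0}$ is the $\Gamma_0$-valued pure-birth process in which, when the current state is $\eta$, a new particle (point) appears in a bounded Borel set $B$ at rate $\int_B b(x,\eta)\,dx$. Precisely, it is the unique c\`adl\`ag $\Gamma_0$-valued solution of $$|\eta_t\cap B| = \int_{(0,t]\times B\times[0,\infty)} \mathbf{1}_{[0,b(x,\eta_{s-})]}(u)\,N(ds,dx,du) + |\eta_0\cap B|,$$ the equality holding a.s. for every $t\ge0$ and every bounded $B\in\mathscr{B}(\mathbb{R})$,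 where $N$ is a Poisson point process on $\mathbb{R}_+\times\mathbb{R}\times\mathbb{R}_+$ with mean measure $ds\times dx\times du$. *)

theory Defs
  imports "HOL-Probability.Probability"
begin

section \<open>Finite configurations\<close>

text \<open>
  The space of finite subsets of the line carries the weak topology of finite counting measures,
  generated by the evaluations against bounded continuous functions.  As the constant function 1
  is allowed, this is the disjoint union over n of the topologies of n-point configurations.
\<close>

definition configs :: "real set set" where
  "configs = {\<eta>. finite \<eta>}"

definition config_topology :: "real set topology" where
  "config_topology = topology_generated_by
     {{\<eta> \<in> configs. (\<Sum>y\<in>\<eta>. f y) \<in> U} | (f :: real \<Rightarrow> real) U.
        continuous_on UNIV f \<and> bounded (range f) \<and> open U}"

definition config_algebra :: "real set measure" where
  "config_algebra = sigma configs {{\<eta> \<in> configs. card (\<eta> \<inter> B) = n} | B n. B \<in> sets borel}"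

definition cadlag :: "'b topology \<Rightarrow> (real \<Rightarrow> 'b) \<Rightarrow> bool" where
  "cadlag T f \<longleftrightarrow>
     (\<forall>t\<ge>0. limitin T f (f t) (at_right t)) \<and>
     (\<forall>t>0. \<exists>l. limitin T f l (at_left t))"

text \<open>The left limit is well defined for configurations by lemma \<open>config_limit_unique\<close> below.\<close>

definition left_limit :: "'b topology \<Rightarrow> (real \<Rightarrow> 'b) \<Rightarrow> real \<Rightarrow> 'b" where
  "left_limit T f t = (THE l. limitin T f l (at_left t))"

lemma topspace_config_topology [simp]: "topspace config_topology = configs"
proof -
  have "configs \<in> {{\<eta> \<in> configs. (\<Sum>y\<in>\<eta>. f y) \<in> U} | (f :: real \<Rightarrow> real) U.
        continuous_on UNIV f \<and> bounded (range f) \<and> open U}"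
    by (rule CollectI, rule exI[of _ "\<lambda>_. 0"], rule exI[of _ UNIV]) (auto simp: bounded_def)
  then show ?thesis
    unfolding config_topology_def topology_generated_by_topspace by blast
qed

lemma config_limit_sum:
  fixes f :: "real \<Rightarrow> real"
  assumes "limitin config_topology h l F" "continuous_on UNIV f" "bounded (range f)"
  shows "((\<lambda>s. \<Sum>y\<in>h s. f y) \<longlongrightarrow> (\<Sum>y\<in>l. f y)) F"
proof (rule topological_tendstoI)
  fix U :: "real set" assume U: "open U" "(\<Sum>y\<in>l. f y) \<in> U"
  have l: "l \<in> configs"
    using assms(1) limitin_topspace by fastforce
  have "openin config_topology {\<eta> \<in> configs. (\<Sum>y\<in>\<eta>. f y) \<in> U}"
    unfolding config_topology_def
    by (rule topology_generated_by_Basis) (use assms(2,3) U(1) in blast)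
  then have "\<forall>\<^sub>F s in F. h s \<in> {\<eta> \<in> configs. (\<Sum>y\<in>\<eta>. f y) \<in> U}"
    using assms(1) l U(2) unfolding limitin_def by blast
  then show "\<forall>\<^sub>F s in F. (\<Sum>y\<in>h s. f y) \<in> U"
    by (rule eventually_mono) simp
qed

lemma config_limit_subset:
  assumes "limitin config_topology h l F" "limitin config_topology h l' F" "F \<noteq> bot"
  shows "l \<subseteq> l'"
proof
  fix x assume x: "x \<in> l"
  have fin: "finite l" "finite l'"
    using assms(1,2) limitin_topspace[of config_topology h] by (auto simp: configs_def)
  show "x \<in> l'"
  proof (rule ccontr)
    assume nx: "x \<notin> l'"
    have "open (- l')" "x \<in> - l'"
      using nx fin(2) by (auto simp: finite_imp_closed open_Compl)
    then obtain d where "d > 0" "ball x d \<subseteq> - l'"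
      using open_contains_ball by blast
    then have d: "d > 0" "ball x d \<inter> l' = {}"
      by auto
    define f where "f y = max 0 (1 - dist x y / d)" for y
    have f: "continuous_on UNIV f" "bounded (range f)"
      unfolding f_def by (intro continuous_intros)
        (use d in \<open>auto simp: bounded_iff intro!: exI[of _ 1]\<close>)
    have "(\<Sum>y\<in>l. f y) = (\<Sum>y\<in>l'. f y)"
      using config_limit_sum[OF assms(1) f] config_limit_sum[OF assms(2) f] assms(3)
      by (rule tendsto_unique[rotated])
    moreover have "(\<Sum>y\<in>l'. f y) = 0"
    proof (intro sum.neutral ballI)
      fix y assume "y \<in> l'"
      then have "d \<le> dist x y"
        using d(2) by (meson disjoint_iff mem_ball not_le)
      then show "f y = 0"
        using d(1) by (simp add: f_def)
    qed
    moreover have "(\<Sum>y\<in>l. f y) \<ge> f x"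
      by (rule member_le_sum[OF x]) (auto simp: f_def fin)
    ultimately show False
      by (simp add: f_def)
  qed
qed

lemma config_limit_unique:
  assumes "limitin config_topology h l F" "limitin config_topology h l' F" "F \<noteq> bot"
  shows "l = l'"
  using config_limit_subset assms by blast

section \<open>Poisson point processes\<close>

text \<open>
  A point process is a random measure with extended natural values.  The law is required for sets
  of finite mean measure (the formula with mean 0 gives the value 0 almost surely).
\<close>

definition poisson_point_process ::
  "'a measure \<Rightarrow> 'b measure \<Rightarrow> ('a \<Rightarrow> 'b measure) \<Rightarrow> bool" where
  "poisson_point_process M \<nu> N \<longleftrightarrow>
     (\<forall>\<omega>\<in>space M. sets (N \<omega>) = sets \<nu> \<and>
        (\<forall>A\<in>sets \<nu>. emeasure (N \<omega>) A \<in> range ennreal_of_enat)) \<and>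
     (\<forall>A\<in>sets \<nu>. (\<lambda>\<omega>. emeasure (N \<omega>) A) \<in> borel_measurable M) \<and>
     (\<forall>A\<in>sets \<nu>. emeasure \<nu> A < \<infinity> \<longrightarrow>
        (\<forall>k::nat. measure M {\<omega> \<in> space M. emeasure (N \<omega>) A = of_nat k} =
            exp (- measure \<nu> A) * measure \<nu> A ^ k / fact k)) \<and>
     (\<forall>(A :: nat \<Rightarrow> 'b set) n.
        (\<forall>i<n. A i \<in> sets \<nu>) \<longrightarrow> disjoint_family_on A {..<n} \<longrightarrow>
        prob_space.indep_vars M (\<lambda>_. borel) (\<lambda>i \<omega>. emeasure (N \<omega>) (A i)) {..<n})"

text \<open>Lebesgue measure on \<open>[0,\<infinity>) \<times> \<real> \<times> [0,\<infinity>)\<close>.\<close>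

definition birth_intensity :: "(real \<times> real \<times> real) measure" where
  "birth_intensity =
     restrict_space lborel {0..} \<Otimes>\<^sub>M (lborel \<Otimes>\<^sub>M restrict_space lborel {0..})"

section \<open>Birth processes\<close>

definition birth_kernel :: "real \<Rightarrow> real \<Rightarrow> real \<Rightarrow> real" where
  "birth_kernel c \<alpha> z = c / (1 + \<bar>z\<bar>\<^sup>2) powr \<alpha>"

definition birth_rate :: "(real \<Rightarrow> real) \<Rightarrow> real \<Rightarrow> real set \<Rightarrow> real" where
  "birth_rate a x \<eta> = min 1 (\<Sum>y\<in>\<eta>. a (x - y))"

text \<open>
  The exceptional null set in the equation may depend on \<open>t\<close> and \<open>B\<close>.  Finiteness of each
  \<open>\<eta> t \<omega>\<close> is part of measurability into \<open>config_algebra\<close>.  Only times \<open>t \<ge> 0\<close> matter.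
\<close>

definition birth_process ::
  "'a measure \<Rightarrow> (real \<Rightarrow> real set \<Rightarrow> real) \<Rightarrow> ('a \<Rightarrow> (real \<times> real \<times> real) measure) \<Rightarrow>
   (real \<Rightarrow> 'a \<Rightarrow> real set) \<Rightarrow> bool" where
  "birth_process M b N \<eta> \<longleftrightarrow>
     (\<forall>t\<ge>0. \<eta> t \<in> M \<rightarrow>\<^sub>M config_algebra) \<and>
     (\<forall>\<omega>\<in>space M. cadlag config_topology (\<lambda>t. \<eta> t \<omega>)) \<and>
     (\<forall>t\<ge>0. \<forall>B\<in>sets borel. bounded B \<longrightarrow>
        (AE \<omega> in M.
           (of_nat (card (\<eta> t \<omega> \<inter> B)) :: ennreal) =
           (\<integral>\<^sup>+ (s, x, u) \<in> {0<..t} \<times> B \<times> {0..}.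
              indicator {0..b x (left_limit config_topology (\<lambda>r. \<eta> r \<omega>) s)} u \<partial>N \<omega>)
           + of_nat (card (\<eta> 0 \<omega> \<inter> B))))"

end

theory Submission
  imports Defs
begin

text \<open>
  At a time \<open>T\<close> of order \<open>m 2\<^sup>m\<close> the process has, up to constants, at least \<open>T 2\<^sup>m\<close> points in
  \<open>[0, 2\<^sup>m]\<close>: the unit cells in this interval are occupied one after the other, and an occupied cell
  keeps producing points at a rate bounded below.  As \<open>\<alpha> \<le> 2\<close>, these points give births at distance
  of order \<open>T\<close> at rate at least of order \<open>T 2\<^sup>m / T\<^sup>4\<close> per unit length, so a birth beyond \<open>K\<^sub>0 + K\<^sub>1 t\<close>
  during a time interval of length \<open>T\<close> has intensity at least of order \<open>2\<^sup>m / T\<close>, that is \<open>1 / m\<close>.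
  The harmonic series diverges, so by Borel-Cantelli such births occur infinitely often.  All events
  are expressed through \<open>N\<close> on deterministic boxes, for which Poisson estimates apply directly and
  neither adaptedness nor the Markov property is needed.
\<close>

section \<open>Limits along cadlag paths of configurations\<close>

lemma left_limit_limitin:
  assumes "cadlag config_topology f" "0 < s"
  shows "limitin config_topology f (left_limit config_topology f s) (at_left s)"
proof -
  obtain l where l: "limitin config_topology f l (at_left s)"
    using assms by (auto simp: cadlag_def)
  have "left_limit config_topology f s = l"
    unfolding left_limit_def
  proof (rule the_equality)
    show "l' = l" if "limitin config_topology f l' (at_left s)" for l'
      using config_limit_unique[OF that l] trivial_limit_at_left_real by blast
  qed (fact l)
  with l show ?thesis by simp
qed

lemma cadlag_finite:
  assumes "cadlag config_topology f" "0 \<le> t"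
  shows "finite (f t)"
proof -
  have "limitin config_topology f (f t) (at_right t)"
    using assms by (simp add: cadlag_def)
  then show ?thesis
    using limitin_topspace by (fastforce simp: configs_def)
qed

text \<open>If the sum at the left limit were below \<open>m\<close>, so would be the sums at all
  times shortly before \<open>s\<close>, rational ones included. Rational times suffice here, which
  allows a single null set for the equation at all the times in question.\<close>

lemma left_limit_sum_ge:
  fixes g :: "real \<Rightarrow> real"
  assumes "cadlag config_topology f" "0 \<le> t" "t < s"
    and "continuous_on UNIV g" "bounded (range g)"
    and ge: "\<And>r. r \<in> \<rat> \<Longrightarrow> t < r \<Longrightarrow> r < s \<Longrightarrow> m \<le> (\<Sum>y\<in>f r. g y)"
  shows "m \<le> (\<Sum>y\<in>left_limit config_topology f s. g y)"
proof (rule ccontr)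
  assume "\<not> ?thesis"
  moreover have "((\<lambda>r. \<Sum>y\<in>f r. g y) \<longlongrightarrow> (\<Sum>y\<in>left_limit config_topology f s. g y)) (at_left s)"
    using assms by (intro config_limit_sum left_limit_limitin) auto
  ultimately have "\<forall>\<^sub>F r in at_left s. (\<Sum>y\<in>f r. g y) < m"
    by (intro order_tendstoD(2)) auto
  then obtain b where b: "b < s" "\<And>r. b < r \<Longrightarrow> r < s \<Longrightarrow> (\<Sum>y\<in>f r. g y) < m"
    using \<open>t < s\<close> by (auto simp: eventually_at_left)
  obtain r where "r \<in> \<rat>" "max b t < r" "r < s"
    using Rats_dense_in_real[of "max b t" s] b(1) \<open>t < s\<close> by auto
  with b(2)[of r] ge[of r] show False by auto
qed

text \<open>A tent function around a point outside \<open>{- L t..L t}\<close> has a positive sum at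
  time \<open>t\<close>, hence also shortly afterwards by right continuity. By continuity of
  \<open>L\<close> the intervals at those times still miss the support of the tent, which
  contradicts the assumption at rational times.\<close>

lemma cadlag_subset_closed_right:
  assumes cad: "cadlag config_topology f" and t: "0 \<le> t"
    and cont: "continuous_on UNIV L"
    and sub: "\<And>r. r \<in> \<rat> \<Longrightarrow> t < r \<Longrightarrow> f r \<subseteq> {- L r..L r}"
  shows "f t \<subseteq> {- L t..L t :: real}"
proof
  fix y assume y: "y \<in> f t"
  have "\<bar>y\<bar> \<le> L t"
  proof (rule ccontr)
    assume "\<not> \<bar>y\<bar> \<le> L t"
    define d where "d = (\<bar>y\<bar> - L t) / 2"
    have d: "d > 0" using \<open>\<not> \<bar>y\<bar> \<le> L t\<close> by (simp add: d_def)
    define g where "g z = max 0 (1 - dist y z / d)" for z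
    have g: "continuous_on UNIV g" "bounded (range g)"
      unfolding g_def by (intro continuous_intros)
        (use d in \<open>auto simp: bounded_iff intro!: exI[of _ 1]\<close>)
    have lim: "limitin config_topology f (f t) (at_right t)"
      using cad t by (simp add: cadlag_def)
    have "0 < g y" by (simp add: g_def)
    also have "g y \<le> (\<Sum>z\<in>f t. g z)"
      using y cadlag_finite[OF cad t] by (intro member_le_sum) (auto simp: g_def)
    finally have "\<forall>\<^sub>F r in at_right t. 0 < (\<Sum>z\<in>f r. g z)"
      using config_limit_sum[OF lim g] order_tendstoD(1) by blast
    moreover have "\<forall>\<^sub>F r in at_right t. L r < \<bar>y\<bar> - d"
    proof (rule order_tendstoD(2))
      show "(L \<longlongrightarrow> L t) (at_right t)"
        using cont by (metis UNIV_I continuous_on_def filterlim_at_split tendsto_within_subset subset_UNIV)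
      show "L t < \<bar>y\<bar> - d" using d by (simp add: d_def field_simps)
    qed
    ultimately have "\<forall>\<^sub>F r in at_right t. 0 < (\<Sum>z\<in>f r. g z) \<and> L r < \<bar>y\<bar> - d"
      by (rule eventually_conj)
    then obtain b where b: "b > t"
        "\<And>r. t < r \<Longrightarrow> r < b \<Longrightarrow> 0 < (\<Sum>z\<in>f r. g z) \<and> L r < \<bar>y\<bar> - d"
      by (auto simp: eventually_at_right[of t "t+1"])
    obtain r where r: "r \<in> \<rat>" "t < r" "r < b"
      using Rats_dense_in_real[of t b] b(1) by auto
    have "(\<Sum>z\<in>f r. g z) = 0"
    proof (intro sum.neutral ballI)
      fix z assume "z \<in> f r"
      then have "z \<in> {- L r..L r}" using sub[OF r(1,2)] by blast
      then have "\<bar>z\<bar> \<le> L r" by auto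
      then have "dist y z \<ge> d" using b(2)[OF r(2,3)] by (auto simp: dist_real_def)
      then show "g z = 0" using d by (simp add: g_def)
    qed
    with b(2)[OF r(2,3)] show False by simp
  qed
  then show "y \<in> {- L t..L t}" by auto
qed

section \<open>Measurability of the containment event\<close>

lemma sets_config_subset:
  assumes "I \<in> sets borel"
  shows "{\<eta> \<in> configs. \<eta> \<subseteq> I} \<in> sets config_algebra"
proof -
  have "{\<eta> \<in> configs. \<eta> \<subseteq> I} = {\<eta> \<in> configs. card (\<eta> \<inter> - I) = 0}"
    by (auto simp: configs_def)
  moreover have "{\<eta> \<in> configs. card (\<eta> \<inter> - I) = 0} \<in> sets config_algebra"
    unfolding config_algebra_def
    by (subst sets_measure_of, blast, rule sigma_sets.Basic) (use assms borel_comp in blast)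
  ultimately show ?thesis by simp
qed

text \<open>By right continuity, containment at all rational times from \<open>n\<close> on gives
  containment at all real ones, so the event is a countable union of countable
  intersections.\<close>

lemma sets_eventually_subset:
  fixes \<eta> :: "real \<Rightarrow> 'a \<Rightarrow> real set" and L :: "real \<Rightarrow> real"
  assumes meas: "\<And>t. 0 \<le> t \<Longrightarrow> \<eta> t \<in> M \<rightarrow>\<^sub>M config_algebra"
    and cad: "\<And>\<omega>. \<omega> \<in> space M \<Longrightarrow> cadlag config_topology (\<lambda>t. \<eta> t \<omega>)"
    and cont: "continuous_on UNIV L"
  shows "{\<omega> \<in> space M. \<forall>\<^sub>F t in at_top. \<eta> t \<omega> \<subseteq> {- L t..L t}} \<in> sets M"
proof -
  have 1: "(\<forall>\<^sub>F t in at_top. \<eta> t \<omega> \<subseteq> {- L t..L t}) \<longleftrightarrow>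
    (\<exists>n::nat. \<forall>q\<in>\<rat>. real n \<le> q \<longrightarrow> \<eta> q \<omega> \<subseteq> {- L q..L q})" if "\<omega> \<in> space M" for \<omega>
  proof
    assume "\<forall>\<^sub>F t in at_top. \<eta> t \<omega> \<subseteq> {- L t..L t}"
    then obtain t0 where t0: "\<And>t. t0 \<le> t \<Longrightarrow> \<eta> t \<omega> \<subseteq> {- L t..L t}"
      by (auto simp: eventually_at_top_linorder)
    obtain n :: nat where "t0 \<le> real n" using real_arch_simple by blast
    then have "\<forall>q\<in>\<rat>. real n \<le> q \<longrightarrow> \<eta> q \<omega> \<subseteq> {- L q..L q}"
      using t0 order_trans by blast
    then show "\<exists>n::nat. \<forall>q\<in>\<rat>. real n \<le> q \<longrightarrow> \<eta> q \<omega> \<subseteq> {- L q..L q}" ..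
  next
    assume "\<exists>n::nat. \<forall>q\<in>\<rat>. real n \<le> q \<longrightarrow> \<eta> q \<omega> \<subseteq> {- L q..L q}"
    then obtain n :: nat where n: "\<And>q. q \<in> \<rat> \<Longrightarrow> real n \<le> q \<Longrightarrow> \<eta> q \<omega> \<subseteq> {- L q..L q}"
      by blast
    have "\<eta> t \<omega> \<subseteq> {- L t..L t}" if "real n \<le> t" for t
      using cadlag_subset_closed_right[OF cad[OF \<open>\<omega> \<in> space M\<close>] _ cont, of t] n that
      by fastforce
    then show "\<forall>\<^sub>F t in at_top. \<eta> t \<omega> \<subseteq> {- L t..L t}"
      by (auto simp: eventually_at_top_linorder)
  qed
  have 2: "{\<omega> \<in> space M. real n \<le> q \<longrightarrow> \<eta> q \<omega> \<subseteq> {- L q..L q}} \<in> sets M" for q and n :: nat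
  proof (cases "real n \<le> q")
    case True
    then have q: "0 \<le> q" using of_nat_0_le_iff order_trans by blast
    have "\<eta> q -` {\<zeta> \<in> configs. \<zeta> \<subseteq> {- L q..L q}} \<inter> space M \<in> sets M"
      by (rule measurable_sets[OF meas[OF q]]) (simp add: sets_config_subset)
    moreover have "\<eta> q \<omega> \<in> configs" if "\<omega> \<in> space M" for \<omega>
      using cadlag_finite[OF cad[OF that] q] by (simp add: configs_def)
    then have "\<eta> q -` {\<zeta> \<in> configs. \<zeta> \<subseteq> {- L q..L q}} \<inter> space M =
        {\<omega> \<in> space M. \<eta> q \<omega> \<subseteq> {- L q..L q}}"
      by auto
    ultimately show ?thesis using True by simp
  qed simp
  have "{\<omega> \<in> space M. \<exists>n::nat. \<forall>q\<in>\<rat>. real n \<le> q \<longrightarrow> \<eta> q \<omega> \<subseteq> {- L q..L q}} \<in> sets M"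
  proof (rule sets.sets_Collect_countable_Ex)
    fix n :: nat
    have "(\<Inter>q\<in>\<rat>. {\<omega> \<in> space M. real n \<le> q \<longrightarrow> \<eta> q \<omega> \<subseteq> {- L q..L q}}) \<in> sets M"
    proof (rule sets.countable_INT'[OF countable_rat])
      show "(\<rat> :: real set) \<noteq> {}" using Rats_0 by blast
      show "(\<lambda>q. {\<omega> \<in> space M. real n \<le> q \<longrightarrow> \<eta> q \<omega> \<subseteq> {- L q..L q}}) ` \<rat> \<subseteq> sets M"
        using 2 by blast
    qed
    also have "(\<Inter>q\<in>\<rat>. {\<omega> \<in> space M. real n \<le> q \<longrightarrow> \<eta> q \<omega> \<subseteq> {- L q..L q}}) =
        {\<omega> \<in> space M. \<forall>q\<in>\<rat>. real n \<le> q \<longrightarrow> \<eta> q \<omega> \<subseteq> {- L q..L q}}"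
      using Rats_0 by blast
    finally show "{\<omega> \<in> space M. \<forall>q\<in>\<rat>. real n \<le> q \<longrightarrow> \<eta> q \<omega> \<subseteq> {- L q..L q}} \<in> sets M" .
  qed
  also have "{\<omega> \<in> space M. \<exists>n::nat. \<forall>q\<in>\<rat>. real n \<le> q \<longrightarrow> \<eta> q \<omega> \<subseteq> {- L q..L q}} =
     {\<omega> \<in> space M. \<forall>\<^sub>F t in at_top. \<eta> t \<omega> \<subseteq> {- L t..L t}}"
    using 1 by blast
  finally show ?thesis .
qed

section \<open>Births read off from deterministic boxes\<close>

text \<open>
  The equation is used only through monotonicity of the integral, which holds for arbitrary
  integrands; hence the measurability of the birth rate along the path plays no role.
\<close>

definition solves ::
  "(real \<Rightarrow> real set \<Rightarrow> real) \<Rightarrow> (real \<times> real \<times> real) measure \<Rightarrow> (real \<Rightarrow> real set) \<Rightarrow> real set \<Rightarrow> bool" where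
  "solves b \<nu> f B \<longleftrightarrow> (\<forall>t\<in>\<rat>. 0 \<le> t \<longrightarrow>
     (of_nat (card (f t \<inter> B)) :: ennreal) =
       (\<integral>\<^sup>+ (s, x, u) \<in> {0<..t} \<times> B \<times> {0..}.
          indicator {0..b x (left_limit config_topology f s)} u \<partial>\<nu>)
       + of_nat (card (f 0 \<inter> B)))"

lemma solves_mono:
  assumes "solves b \<nu> f B" "t \<in> \<rat>" "t' \<in> \<rat>" "0 \<le> t" "t \<le> t'"
  shows "card (f t \<inter> B) \<le> card (f t' \<inter> B)"
proof -
  have le: "F z * indicator ({0<..t} \<times> B \<times> {0..}) z \<le> F z * (indicator ({0<..t'} \<times> B \<times> {0..}) z :: ennreal)"
    for F :: "real \<times> real \<times> real \<Rightarrow> ennreal" and z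
    using \<open>t \<le> t'\<close> by (intro mult_left_mono indicator_leI) auto
  have "(of_nat (card (f t \<inter> B)) :: ennreal) =
       (\<integral>\<^sup>+ (s, x, u) \<in> {0<..t} \<times> B \<times> {0..}.
          indicator {0..b x (left_limit config_topology f s)} u \<partial>\<nu>)
       + of_nat (card (f 0 \<inter> B))"
    using assms unfolding solves_def by blast
  also have "\<dots> \<le> (\<integral>\<^sup>+ (s, x, u) \<in> {0<..t'} \<times> B \<times> {0..}.
          indicator {0..b x (left_limit config_topology f s)} u \<partial>\<nu>)
       + of_nat (card (f 0 \<inter> B))"
    by (intro add_right_mono nn_integral_mono le)
  also have "\<dots> = of_nat (card (f t' \<inter> B))"
    using assms unfolding solves_def by fastforce
  finally show ?thesis by simp
qed

text \<open>Where the birth rate is at least \<open>h\<close>, everything that \<open>\<nu>\<close>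
  has below height \<open>h\<close> is accepted as a birth, so the box lies in the region counted by
  the integral. The box is deterministic although the rate depends on the path, so its content can
  be controlled by the Poisson law alone.\<close>

lemma solves_birth:
  assumes "solves b \<nu> f B" "t \<in> \<rat>" "t' \<in> \<rat>" "0 \<le> t" "t \<le> t'"
    and "{t<..t'} \<times> (B \<times> {0..h}) \<in> sets \<nu>"
    and "\<And>s x. t < s \<Longrightarrow> s \<le> t' \<Longrightarrow> x \<in> B \<Longrightarrow> h \<le> b x (left_limit config_topology f s)"
  shows "emeasure \<nu> ({t<..t'} \<times> (B \<times> {0..h})) \<le> of_nat (card (f t' \<inter> B))"
proof -
  have le: "indicator ({t<..t'} \<times> (B \<times> {0..h})) z \<le>
      (case z of (s, x, u) \<Rightarrow> indicator {0..b x (left_limit config_topology f s)} u) *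
      (indicator ({0<..t'} \<times> B \<times> {0..}) z :: ennreal)" for z
  proof (cases "z \<in> {t<..t'} \<times> (B \<times> {0..h})")
    case True
    then obtain s x u where z: "z = (s, x, u)" "t < s" "s \<le> t'" "x \<in> B" "0 \<le> u" "u \<le> h"
      by auto
    with assms(4) assms(7)[of s x] show ?thesis by auto
  qed simp
  have "emeasure \<nu> ({t<..t'} \<times> (B \<times> {0..h})) = (\<integral>\<^sup>+ z. indicator ({t<..t'} \<times> (B \<times> {0..h})) z \<partial>\<nu>)"
    by (rule nn_integral_indicator[symmetric]) fact
  also have "\<dots> \<le> (\<integral>\<^sup>+ (s, x, u) \<in> {0<..t'} \<times> B \<times> {0..}.
          indicator {0..b x (left_limit config_topology f s)} u \<partial>\<nu>)"
    by (intro nn_integral_mono le)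
  also have "\<dots> \<le> of_nat (card (f t' \<inter> B))"
  proof -
    have "0 \<le> t'" using assms by simp
    with \<open>t' \<in> \<rat>\<close> assms(1) have "of_nat (card (f t' \<inter> B)) =
        (\<integral>\<^sup>+ (s, x, u) \<in> {0<..t'} \<times> B \<times> {0..}.
          indicator {0..b x (left_limit config_topology f s)} u \<partial>\<nu>) + of_nat (card (f 0 \<inter> B))"
      unfolding solves_def by blast
    then show ?thesis
      by (rule ssubst) simp
  qed
  finally show ?thesis .
qed

text \<open>The count in \<open>B\<close> does not drop after time \<open>t\<close>, and each point
  of \<open>B\<close> adds at least \<open>k\<close> to the sum. A translate of the reflected kernel
  is a continuous bounded test function, so the bound passes to the left limit.\<close>

lemma birth_rate_left_limit_ge:
  assumes cad: "cadlag config_topology f" and sol: "solves b \<nu> f B"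
    and a: "continuous_on UNIV a" "bounded (range a)" "\<And>z. 0 \<le> a z"
    and t: "t \<in> \<rat>" "0 \<le> t" "t < s"
    and n: "n \<le> real (card (f t \<inter> B))" and k: "0 \<le> k" "\<And>y. y \<in> B \<Longrightarrow> k \<le> a (x - y)"
  shows "min 1 (n * k) \<le> birth_rate a x (left_limit config_topology f s)"
proof -
  have "n * k \<le> (\<Sum>y\<in>left_limit config_topology f s. a (x - y))"
  proof (rule left_limit_sum_ge[OF cad t(2,3)])
    show "continuous_on UNIV (\<lambda>y. a (x - y))"
      by (rule continuous_on_compose2[OF a(1)]) (auto intro!: continuous_intros)
    show "bounded (range (\<lambda>y. a (x - y)))"
      using a(2) by (rule bounded_subset) auto
    fix r assume r: "r \<in> \<rat>" "t < r"
    have fin: "finite (f r)"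
      using cadlag_finite[OF cad] r t by auto
    have "card (f t \<inter> B) \<le> card (f r \<inter> B)"
      using solves_mono[OF sol t(1) r(1)] r t by simp
    then have "n * k \<le> real (card (f r \<inter> B)) * k"
      using n k(1) by (intro mult_right_mono) auto
    also have "\<dots> \<le> (\<Sum>y\<in>f r \<inter> B. a (x - y))"
      using k(2) by (intro sum_bounded_below) auto
    also have "\<dots> \<le> (\<Sum>y\<in>f r. a (x - y))"
      using fin a(3) by (intro sum_mono2) auto
    finally show "n * k \<le> (\<Sum>y\<in>f r. a (x - y))" .
  qed
  then show ?thesis by (auto simp: birth_rate_def)
qed

section \<open>Bounds for the birth kernel\<close>

lemma continuous_birth_kernel: "continuous_on UNIV (birth_kernel c \<alpha>)"
  unfolding birth_kernel_def by (intro continuous_intros) (auto simp: add_nonneg_eq_0_iff)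

lemma birth_kernel_nonneg: "0 \<le> c \<Longrightarrow> 0 \<le> birth_kernel c \<alpha> z"
  by (simp add: birth_kernel_def)

lemma birth_kernel_antimono:
  assumes "0 \<le> c" "0 \<le> \<alpha>" "\<bar>z\<bar> \<le> \<bar>z'\<bar>"
  shows "birth_kernel c \<alpha> z' \<le> birth_kernel c \<alpha> z"
  unfolding birth_kernel_def using assms
  by (intro divide_left_mono powr_mono2 add_left_mono power_mono mult_pos_pos powr_gt_zero[THEN iffD2])
     (auto simp: add_nonneg_eq_0_iff)

lemma bounded_birth_kernel:
  assumes "0 \<le> c" "0 \<le> \<alpha>"
  shows "bounded (range (birth_kernel c \<alpha>))"
  unfolding bounded_iff using birth_kernel_antimono[OF assms, of 0] birth_kernel_nonneg[OF assms(1)]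
  by (intro exI[of _ "birth_kernel c \<alpha> 0"]) auto

text \<open>The base \<open>1 + z\<^sup>2\<close> is at least 1, so \<alpha> = 2 is the worst case.
  The resulting decay of fourth order is just slow enough for the harmonic divergence in
  \<open>birth_process_exceeds\<close>.\<close>

lemma birth_kernel_ge:
  assumes "0 \<le> c" "\<alpha> \<le> 2"
  shows "c / (1 + z\<^sup>2)\<^sup>2 \<le> birth_kernel c \<alpha> z"
proof -
  have "(1 + z\<^sup>2) powr \<alpha> \<le> (1 + z\<^sup>2) powr 2"
    using assms by (intro powr_mono) auto
  also have "\<dots> = (1 + z\<^sup>2)\<^sup>2"
    by (simp add: powr_numeral add_nonneg_eq_0_iff add_pos_nonneg)
  finally show ?thesis
    unfolding birth_kernel_def using assms(1) 
    by (auto intro!: divide_left_mono mult_pos_pos simp: add_nonneg_eq_0_iff)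
qed

section \<open>Intensity of boxes\<close>

lemma sets_box:
  assumes "B \<in> sets borel" "0 \<le> t"
  shows "{t<..t'} \<times> (B \<times> {0..h}) \<in> sets birth_intensity"
proof -
  have "{t<..t'} \<in> sets (restrict_space lborel {0..})" "{0..h} \<in> sets (restrict_space lborel {0..})"
    using assms by (auto simp: sets_restrict_space_iff)
  then show ?thesis
    unfolding birth_intensity_def using assms by (intro pair_measureI) auto
qed

lemma emeasure_box:
  assumes "B \<in> sets borel" "0 \<le> t" "t \<le> t'" "0 \<le> h"
  shows "emeasure birth_intensity ({t<..t'} \<times> (B \<times> {0..h})) = ennreal (t' - t) * (emeasure lborel B * ennreal h)"
proof -
  have s: "{t<..t'} \<in> sets (restrict_space lborel {0..})" "{0..h} \<in> sets (restrict_space lborel {0..})"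
    using assms by (auto simp: sets_restrict_space_iff)
  interpret R: sigma_finite_measure "restrict_space lborel {0::real..}"
    by (rule sigma_finite_measure_restrict_space) (auto intro: lborel.sigma_finite_measure_axioms)
  interpret P: pair_sigma_finite lborel "restrict_space lborel {0::real..}" ..
  have "{t<..t'} \<subseteq> {0..}"
    using assms by auto
  then have e: "emeasure (restrict_space lborel {0..}) {t<..t'} = ennreal (t' - t)"
     "emeasure (restrict_space lborel {0..}) {0..h} = ennreal h"
    using assms by (simp_all add: emeasure_restrict_space)
  have B: "B \<times> {0..h} \<in> sets (lborel \<Otimes>\<^sub>M restrict_space lborel {0..})"
    using assms s by (intro pair_measureI) auto
  have "emeasure birth_intensity ({t<..t'} \<times> (B \<times> {0..h})) =
      ennreal (t' - t) * emeasure (lborel \<Otimes>\<^sub>M restrict_space lborel {0::real..}) (B \<times> {0..h})"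
    unfolding birth_intensity_def
    by (subst P.emeasure_pair_measure_Times[OF s(1) B]) (simp only: e)
  also have "emeasure (lborel \<Otimes>\<^sub>M restrict_space lborel {0::real..}) (B \<times> {0..h}) = 
      emeasure lborel B * ennreal h"
    using assms(1) s(2) by (subst R.emeasure_pair_measure_Times) (simp_all only: e sets_lborel)
  finally show ?thesis .
qed

lemma measure_box:
  assumes "B \<in> sets borel" "emeasure lborel B = ennreal b" "0 \<le> t" "t \<le> t'" "0 \<le> b" "0 \<le> h"
  shows "emeasure birth_intensity ({t<..t'} \<times> (B \<times> {0..h})) < \<infinity>"
    and "measure birth_intensity ({t<..t'} \<times> (B \<times> {0..h})) = (t' - t) * (b * h)"
proof -
  have "emeasure birth_intensity ({t<..t'} \<times> (B \<times> {0..h})) = ennreal (t' - t) * (ennreal b * ennreal h)"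
    using assms by (simp only: emeasure_box)
  also have "\<dots> = ennreal ((t' - t) * (b * h))"
    using assms by (simp only: ennreal_mult[symmetric] mult_nonneg_nonneg diff_ge_0_iff_ge)
  finally have e: "emeasure birth_intensity ({t<..t'} \<times> (B \<times> {0..h})) = ennreal ((t' - t) * (b * h))" .
  show "emeasure birth_intensity ({t<..t'} \<times> (B \<times> {0..h})) < \<infinity>"
    unfolding e by simp
  have "0 \<le> (t' - t) * (b * h)"
    using assms by (intro mult_nonneg_nonneg) auto
  then show "measure birth_intensity ({t<..t'} \<times> (B \<times> {0..h})) = (t' - t) * (b * h)"
    unfolding measure_def e by (rule enn2real_ennreal)
qed

section \<open>Poisson estimates\<close>

lemma (in prob_space) poisson_eq_0:
  assumes "poisson_point_process M \<nu> N" "A \<in> sets \<nu>" "emeasure \<nu> A < \<infinity>"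
  shows "prob {\<omega> \<in> space M. emeasure (N \<omega>) A = 0} = exp (- measure \<nu> A)"
proof -
  have "\<forall>k::nat. measure M {\<omega> \<in> space M. emeasure (N \<omega>) A = of_nat k} =
            exp (- measure \<nu> A) * measure \<nu> A ^ k / fact k"
    using assms unfolding poisson_point_process_def by blast
  from this[rule_format, of 0] show ?thesis by simp
qed

text \<open>Chernoff bound: for \<open>k\<close> at most \<open>\<mu> / 4\<close> the Poisson weight
  is multiplied by \<open>exp (\<mu> / 4 - real k)\<close>, which is at least 1, and the sum over
  \<open>k\<close> is completed to the series of \<open>exp (\<mu> / exp 1)\<close>. As
  \<open>exp 1\<close> is at least 2, the coefficient of \<open>\<mu>\<close> in the exponent is at
  most - 3/4 + 1/2 = - 1/4.\<close>

lemma (in prob_space) poisson_lower_tail: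
  assumes N: "poisson_point_process M \<nu> N" and A: "A \<in> sets \<nu>" "emeasure \<nu> A < \<infinity>"
  shows "prob {\<omega> \<in> space M. emeasure (N \<omega>) A \<le> ennreal (measure \<nu> A / 4)} \<le> exp (- measure \<nu> A / 4)"
proof -
  define \<mu> where "\<mu> = measure \<nu> A"
  have \<mu>: "0 \<le> \<mu>" by (simp add: \<mu>_def)
  define E where "E k = {\<omega> \<in> space M. emeasure (N \<omega>) A = of_nat k}" for k
  have law: "prob (E k) = exp (- \<mu>) * \<mu> ^ k / fact k" for k
    using N A unfolding poisson_point_process_def E_def \<mu>_def by blast
  have rv [measurable]: "(\<lambda>\<omega>. emeasure (N \<omega>) A) \<in> borel_measurable M"
    using N A unfolding poisson_point_process_def by blast
  have E: "E k \<in> events" for k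
    unfolding E_def by measurable
  define K where "K = {k. real k \<le> \<mu> / 4}"
  have "K \<subseteq> {..nat \<lfloor>\<mu> / 4\<rfloor>}"
    by (auto simp: K_def le_nat_floor)
  then have K: "finite K"
    by (rule finite_subset) simp
  have "{\<omega> \<in> space M. emeasure (N \<omega>) A \<le> ennreal (\<mu> / 4)} \<subseteq> (\<Union>k\<in>K. E k)"
  proof
    fix \<omega> assume \<omega>: "\<omega> \<in> {\<omega> \<in> space M. emeasure (N \<omega>) A \<le> ennreal (\<mu> / 4)}"
    then have "emeasure (N \<omega>) A \<in> range ennreal_of_enat"
      using N A unfolding poisson_point_process_def by blast
    then obtain n where n: "emeasure (N \<omega>) A = ennreal_of_enat n"
      by blast
    show "\<omega> \<in> (\<Union>k\<in>K. E k)"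
    proof (cases n)
      case (enat k)
      then have k: "emeasure (N \<omega>) A = of_nat k" using n by simp
      then have "ennreal (real k) \<le> ennreal (\<mu> / 4)"
        using \<omega> by (simp add: ennreal_of_nat_eq_real_of_nat)
      then have "k \<in> K" using \<mu> by (simp add: K_def)
      with k \<omega> show ?thesis by (auto simp: E_def)
    next
      case infinity
      with n \<omega> show ?thesis by (auto simp: top_unique)
    qed
  qed
  then have "prob {\<omega> \<in> space M. emeasure (N \<omega>) A \<le> ennreal (\<mu> / 4)} \<le> prob (\<Union>k\<in>K. E k)"
    using E K by (intro finite_measure_mono) auto
  also have "\<dots> \<le> (\<Sum>k\<in>K. prob (E k))"
    using E K by (intro finite_measure_subadditive_finite) auto
  also have "\<dots> \<le> (\<Sum>k\<in>K. exp (- (3/4) * \<mu>) * ((\<mu> / exp 1) ^ k / fact k))"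
  proof (intro sum_mono)
    fix k assume "k \<in> K"
    then have "exp (- \<mu>) * 1 \<le> exp (- \<mu>) * exp (\<mu> / 4 - real k)"
      by (intro mult_left_mono) (auto simp: K_def)
    also have "\<dots> = exp (- (3/4) * \<mu>) / exp 1 ^ k"
      by (simp add: exp_diff[symmetric] exp_add[symmetric] exp_of_nat_mult[symmetric])
    finally have "exp (- \<mu>) * (\<mu> ^ k / fact k) \<le> exp (- (3/4) * \<mu>) / exp 1 ^ k * (\<mu> ^ k / fact k)"
      using \<mu> by (intro mult_right_mono) auto
    then show "prob (E k) \<le> exp (- (3/4) * \<mu>) * ((\<mu> / exp 1) ^ k / fact k)"
      by (simp add: law power_divide)
  qed
  also have "\<dots> = exp (- (3/4) * \<mu>) * (\<Sum>k\<in>K. (\<mu> / exp 1) ^ k / fact k)"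
    by (simp add: sum_distrib_left)
  also have "\<dots> \<le> exp (- (3/4) * \<mu>) * exp (\<mu> / exp 1)"
  proof (intro mult_left_mono)
    have "(\<Sum>k\<in>K. (\<mu> / exp 1) ^ k / fact k) \<le> (\<Sum>k. (\<mu> / exp 1) ^ k / fact k)"
      using summable_exp[of "\<mu> / exp 1"] K \<mu>
      by (intro sum_le_suminf) (auto simp: field_simps)
    then show "(\<Sum>k\<in>K. (\<mu> / exp 1) ^ k / fact k) \<le> exp (\<mu> / exp 1)"
      by (simp add: exp_def scaleR_conv_of_real field_simps)
  qed simp
  also have "\<dots> \<le> exp (- (3/4) * \<mu>) * exp (\<mu> / 2)"
  proof -
    have "\<mu> / exp 1 \<le> \<mu> / 2"
      using exp_ge_add_one_self[of 1] \<mu> by (intro divide_left_mono) auto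
    then show ?thesis by simp
  qed
  also have "\<dots> = exp (- \<mu> / 4)"
    by (simp add: exp_add[symmetric])
  finally show ?thesis by (simp add: \<mu>_def)
qed

text \<open>Second Borel-Cantelli argument: by independence, \<open>n\<close> consecutive sets from
  index \<open>m\<close> on are all empty with probability \<open>exp\<close> of minus a partial
  sum, which divergence makes arbitrarily small.\<close>

lemma (in prob_space) poisson_infinitely_often:
  assumes N: "poisson_point_process M \<nu> N"
    and D: "\<And>m. D m \<in> sets \<nu>" "\<And>m. emeasure \<nu> (D m) < \<infinity>" "disjoint_family D"
    and div: "\<not> summable (\<lambda>m. measure \<nu> (D m))"
  shows "AE \<omega> in M. \<exists>\<^sub>\<infinity>m. emeasure (N \<omega>) (D m) \<noteq> 0"
proof -
  have rv [measurable]: "(\<lambda>\<omega>. emeasure (N \<omega>) (D m)) \<in> borel_measurable M" for m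
    using N D unfolding poisson_point_process_def by blast
  have "AE \<omega> in M. \<exists>i. emeasure (N \<omega>) (D (m + i)) \<noteq> 0" for m
  proof -
    define Z where "Z i = {\<omega> \<in> space M. emeasure (N \<omega>) (D (m + i)) = 0}" for i
    have Z: "Z i \<in> events" for i
      unfolding Z_def by measurable
    have prob: "prob (\<Inter>i. Z i) \<le> exp (- (\<Sum>i<n. measure \<nu> (D (m + i))))" for n
    proof (cases "n = 0")
      \<comment> \<open>The product formula for independent variables needs a nonempty index set;
        for \<open>n = 0\<close> the bound is 1.\<close>
      case False
      have "disjoint_family_on (\<lambda>i. D (m + i)) {..<n}"
        using D(3) by (auto simp: disjoint_family_on_def)
      then have ind: "indep_vars (\<lambda>_. borel) (\<lambda>i \<omega>. emeasure (N \<omega>) (D (m + i))) {..<n}"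
        using N[unfolded poisson_point_process_def, THEN conjunct2, THEN conjunct2, THEN conjunct2,
          rule_format, of n "\<lambda>i. D (m + i)"] D(1) by blast
      have Zeq: "(\<lambda>\<omega>. emeasure (N \<omega>) (D (m + i))) -` {0} \<inter> space M = Z i" for i
        by (auto simp: Z_def)
      have "prob (\<Inter>i. Z i) \<le> prob (\<Inter>i\<in>{..<n}. Z i)"
        using Z False by (intro finite_measure_mono) auto
      also have "\<dots> = (\<Prod>i<n. prob (Z i))"
        using indep_varsD_finite[OF ind, of "\<lambda>_. {0}"] False by (simp add: Zeq lessThan_empty_iff)
      also have "\<dots> = (\<Prod>i<n. exp (- measure \<nu> (D (m + i))))"
        using poisson_eq_0[OF N D(1,2)] by (simp add: Z_def)
      also have "\<dots> = exp (- (\<Sum>i<n. measure \<nu> (D (m + i))))"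
        by (simp add: exp_sum[symmetric] sum_negf)
      finally show ?thesis .
    qed simp
    have "prob (\<Inter>i. Z i) \<le> 0"
    proof (rule field_le_epsilon)
      fix e :: real assume "0 < e"
      have "\<not> summable (\<lambda>i. measure \<nu> (D (m + i)))"
        using div summable_iff_shift[of "\<lambda>i. measure \<nu> (D i)" m] by (simp add: add.commute)
      moreover have "summable (\<lambda>i. measure \<nu> (D (m + i)))"
        if "\<And>n. (\<Sum>i<n. measure \<nu> (D (m + i))) \<le> - ln e"
        by (rule summableI_nonneg_bounded[OF _ that]) simp
      ultimately obtain n where "- ln e < (\<Sum>i<n. measure \<nu> (D (m + i)))"
        by (meson not_less)
      then have "exp (- (\<Sum>i<n. measure \<nu> (D (m + i)))) \<le> exp (ln e)"
        by simp
      with prob[of n] \<open>0 < e\<close> show "prob (\<Inter>i. Z i) \<le> 0 + e" by simp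
    qed
    then have "prob (\<Inter>i. Z i) = 0"
      by (simp add: measure_le_0_iff)
    then have "AE \<omega> in M. \<omega> \<notin> (\<Inter>i. Z i)"
      using Z by (intro AE_not_in) (auto simp: null_sets_def emeasure_eq_measure)
    with AE_space show ?thesis
      by eventually_elim (auto simp: Z_def)
  qed
  then have "AE \<omega> in M. \<forall>m. \<exists>i. emeasure (N \<omega>) (D (m + i)) \<noteq> 0"
    by (simp add: AE_all_countable)
  then show ?thesis
  proof eventually_elim
    case (elim \<omega>)
    show ?case
      unfolding INFM_nat_le
    proof
      fix m
      from elim obtain i where "emeasure (N \<omega>) (D (m + i)) \<noteq> 0" by blast
      then show "\<exists>n\<ge>m. emeasure (N \<omega>) (D n) \<noteq> 0" using le_add1 by blast
    qed
  qed
qed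

section \<open>Occupation of the cells\<close>

text \<open>
  In the chain of cells \<open>[k, k + 1]\<close>, an occupied cell gives birth in the next one during the
  \<open>k\<close>-th window of length \<open>L\<close>.  The windows are deterministic, so no Markov property is needed.
\<close>

lemma cells_occupied:
  fixes L K :: nat
  assumes cad: "cadlag config_topology f"
    and sol: "\<And>k::nat. solves (birth_rate a) \<nu> f {real k..real k + 1}"
    and a: "continuous_on UNIV a" "bounded (range a)" "\<And>z. 0 \<le> a z"
    and p: "0 \<le> p" "p \<le> 1" "\<And>z. \<bar>z\<bar> \<le> 2 \<Longrightarrow> p \<le> a z"
    and \<nu>: "sets \<nu> = sets birth_intensity" and f0: "f 0 = {0}"
    and hit: "\<And>k. k < K \<Longrightarrow> emeasure \<nu>
      ({real (k * L)<..real (Suc k * L)} \<times> ({real (Suc k)..real (Suc k) + 1} \<times> {0..p})) \<noteq> 0"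
  shows "k \<le> K \<Longrightarrow> f (real (k * L)) \<inter> {real k..real k + 1} \<noteq> {}"
proof (induction k)
  case 0
  then show ?case by (simp add: f0)
next
  case (Suc k)
  let ?B = "{real k..real k + 1}" and ?B' = "{real (Suc k)..real (Suc k) + 1}"
  have "finite (f (real (k * L)))"
    by (rule cadlag_finite[OF cad]) simp
  with Suc have n: "1 \<le> real (card (f (real (k * L)) \<inter> ?B))"
    by (simp add: Suc_le_eq card_gt_0_iff)
  have "emeasure \<nu> ({real (k * L)<..real (Suc k * L)} \<times> (?B' \<times> {0..p}))
      \<le> of_nat (card (f (real (Suc k * L)) \<inter> ?B'))"
  proof (rule solves_birth[OF sol])
    fix s x assume s: "real (k * L) < s" and x: "x \<in> ?B'"
    \<comment> \<open>Points of neighbouring cells are at distance at most 2, so a single point of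
      cell \<open>k\<close> already gives the rate \<open>p\<close>.\<close>
    have "min 1 (1 * p) \<le> birth_rate a x (left_limit config_topology f s)"
      using x p by (intro birth_rate_left_limit_ge[OF cad sol[of k] a _ _ s n]) auto
    then show "p \<le> birth_rate a x (left_limit config_topology f s)"
      using p by simp
  next
    show "{real (k * L)<..real (Suc k * L)} \<times> (?B' \<times> {0..p}) \<in> sets \<nu>"
      unfolding \<nu> by (rule sets_box) auto
  qed auto
  with hit[of k] Suc.prems have "card (f (real (Suc k * L)) \<inter> ?B') \<noteq> 0"
    by (metis Suc_le_eq le_zero_eq of_nat_0)
  then show ?case by force
qed

text \<open>After time \<open>T\<close> each \<open>x\<close> in \<open>{0..real K}\<close> shares a
  cell with a point of the configuration, so the rate is at least \<open>p\<close> on the whole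
  interval and \<open>solves_birth\<close> applies to it at once.\<close>

lemma cells_mass:
  fixes L K :: nat
  assumes cad: "cadlag config_topology f"
    and sol: "\<And>k::nat. solves (birth_rate a) \<nu> f {real k..real k + 1}"
      "solves (birth_rate a) \<nu> f {0..real K}"
    and a: "continuous_on UNIV a" "bounded (range a)" "\<And>z. 0 \<le> a z"
    and p: "0 \<le> p" "p \<le> 1" "\<And>z. \<bar>z\<bar> \<le> 2 \<Longrightarrow> p \<le> a z"
    and \<nu>: "sets \<nu> = sets birth_intensity"
    and occ: "\<And>k. k \<le> K \<Longrightarrow> f (real (k * L)) \<inter> {real k..real k + 1} \<noteq> {}"
    and T: "T \<in> \<rat>" "real (K * L) \<le> T" "T' \<in> \<rat>" "T \<le> T'"
  shows "emeasure \<nu> ({T<..T'} \<times> ({0..real K} \<times> {0..p})) \<le> of_nat (card (f T' \<inter> {0..real K}))"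
proof (rule solves_birth[OF sol(2)])
  fix s x assume s: "T < s" and x: "x \<in> {0..real K}"
  \<comment> \<open>With the floor, the endpoint \<open>x = real K\<close> falls into cell
    \<open>K\<close>, so \<open>occ\<close> has to include \<open>k = K\<close>.\<close>
  define k where "k = nat \<lfloor>x\<rfloor>"
  have k: "real k \<le> x" "x \<le> real k + 1"
    using x of_int_floor_le[of x] floor_le_iff[of x "\<lfloor>x\<rfloor>"] unfolding k_def by (simp_all add: of_nat_nat)
  then have "real k \<le> real K"
    using x by auto
  then have kK: "k \<le> K" by simp
  have "finite (f (real (k * L)))"
    by (rule cadlag_finite[OF cad]) simp
  with occ[OF kK] have n: "1 \<le> real (card (f (real (k * L)) \<inter> {real k..real k + 1}))"
    by (simp add: Suc_le_eq card_gt_0_iff)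
  have "real (k * L) \<le> real (K * L)"
    using kK by (simp only: of_nat_le_iff mult_le_mono1)
  then have ks: "real (k * L) < s"
    using T s by linarith
  have "min 1 (1 * p) \<le> birth_rate a x (left_limit config_topology f s)"
    using k p by (intro birth_rate_left_limit_ge[OF cad sol(1)[of k] a _ _ ks n]) auto
  then show "p \<le> birth_rate a x (left_limit config_topology f s)"
    using p by simp
next
  have "0 \<le> T" using T by (meson of_nat_0_le_iff order_trans)
  then show "{T<..T'} \<times> ({0..real K} \<times> {0..p}) \<in> sets \<nu>" "0 \<le> T"
    unfolding \<nu> by (auto intro!: sets_box)
qed (use T in auto)

text \<open>The points of \<open>B\<close>, at least \<open>n\<close> in number, each contribute at
  least \<open>r\<close> at every \<open>x\<close> in \<open>B'\<close>. The rate on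
  \<open>B'\<close> is then at least \<open>h\<close> after time \<open>T\<close>, and a nonempty
  box forces a birth there.\<close>

lemma birth_far_away:
  assumes cad: "cadlag config_topology f"
    and sol: "solves (birth_rate a) \<nu> f B" "solves (birth_rate a) \<nu> f B'"
    and a: "continuous_on UNIV a" "bounded (range a)" "\<And>z. 0 \<le> a z"
    and \<nu>: "sets \<nu> = sets birth_intensity" and B': "B' \<in> sets borel"
    and T: "T \<in> \<rat>" "0 \<le> T" "T' \<in> \<rat>" "T \<le> T'"
    and n: "n \<le> real (card (f T \<inter> B))"
    and r: "0 \<le> r" "\<And>x y. x \<in> B' \<Longrightarrow> y \<in> B \<Longrightarrow> r \<le> a (x - y)"
    and h: "h \<le> 1" "h \<le> n * r"
    and hit: "emeasure \<nu> ({T<..T'} \<times> (B' \<times> {0..h})) \<noteq> 0"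
  shows "f T' \<inter> B' \<noteq> {}"
proof -
  have "emeasure \<nu> ({T<..T'} \<times> (B' \<times> {0..h})) \<le> of_nat (card (f T' \<inter> B'))"
  proof (rule solves_birth[OF sol(2) T(1,3,2,4)])
    fix s x assume s: "T < s" and x: "x \<in> B'"
    have "min 1 (n * r) \<le> birth_rate a x (left_limit config_topology f s)"
      using r x by (intro birth_rate_left_limit_ge[OF cad sol(1) a T(1,2) s n]) auto
    then show "h \<le> birth_rate a x (left_limit config_topology f s)"
      using h by simp
  next
    show "{T<..T'} \<times> (B' \<times> {0..h}) \<in> sets \<nu>"
      unfolding \<nu> using B' T by (intro sets_box)
  qed
  with hit have "card (f T' \<inter> B') \<noteq> 0"
    by (metis le_zero_eq of_nat_0)
  then show ?thesis by force
qed

section \<open>Good scales\<close>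

text \<open>
  At scale \<open>m\<close> the \<open>2 ^ Suc m\<close> cells are occupied one after the other in windows of length
  \<open>C * Suc m\<close>.  The factor \<open>Suc m\<close> makes the failure probability summable in a union bound over all
  cells; it costs a logarithm in the speed, which the divergence of the harmonic series absorbs.
\<close>

definition scale_time :: "nat \<Rightarrow> nat \<Rightarrow> nat" where
  "scale_time C m = 2 ^ Suc m * (C * Suc m)"

lemma scale_time_ge:
  assumes "0 < C"
  shows "2 ^ Suc m \<le> scale_time C m" "m \<le> scale_time C m" "1 \<le> scale_time C m"
proof -
  have "2 ^ Suc m * 1 \<le> scale_time C m"
    unfolding scale_time_def using assms by (intro mult_le_mono2) simp
  then show 1: "2 ^ Suc m \<le> scale_time C m" by simp
  have "Suc m < 2 ^ Suc m" by (rule less_exp)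
  with 1 show "m \<le> scale_time C m" "1 \<le> scale_time C m" by linarith+
qed

text \<open>This keeps apart the time windows from twice to three times
  \<open>scale_time C m\<close> at different scales: a later window starts at four times
  \<open>scale_time C m\<close> or beyond.\<close>

lemma scale_time_double:
  assumes "m < m'"
  shows "2 * scale_time C m \<le> scale_time C m'"
proof -
  have "2 ^ Suc (Suc m) * (C * Suc m) \<le> 2 ^ Suc m' * (C * Suc m')"
    using assms by (intro mult_le_mono power_increasing) auto
  then show ?thesis by (simp add: scale_time_def)
qed

text \<open>First Borel-Cantelli argument. The box of one cell has mean
  \<open>p * C * Suc m\<close>, so by the choice of \<open>C\<close> it is empty with probability at
  most \<open>(1 / 4) ^ Suc m\<close>; the sum over \<open>2 ^ Suc m\<close> cells is at most
  \<open>(1 / 2) ^ Suc m\<close>. The threshold for the last box is a quarter of its mean, as in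
  \<open>poisson_lower_tail\<close>.\<close>

lemma (in prob_space) poisson_scales_good:
  fixes C :: nat
  assumes N: "poisson_point_process M birth_intensity N"
    and p: "0 < p" and C: "0 < C" "ln 4 \<le> p * real C"
  shows "AE \<omega> in M. \<forall>\<^sub>F m in sequentially.
    (\<forall>k<2 ^ Suc m. emeasure (N \<omega>) ({real (k * (C * Suc m))<..real (Suc k * (C * Suc m))} \<times>
        ({real (Suc k)..real (Suc k) + 1} \<times> {0..p})) \<noteq> 0) \<and>
    ennreal (p * scale_time C m * 2 ^ Suc m / 4) < emeasure (N \<omega>)
      ({real (scale_time C m)<..2 * real (scale_time C m)} \<times> ({0..2 ^ Suc m} \<times> {0..p}))"
proof -
  define A where "A m k = {real (k * (C * Suc m))<..real (Suc k * (C * Suc m))} \<times>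
        ({real (Suc k)..real (Suc k) + 1} \<times> {0..p})" for m k :: nat
  define T where "T m = real (scale_time C m)" for m
  define A' where "A' m = {T m<..2 * T m} \<times> ({0..(2 :: real) ^ Suc m} \<times> {0..p})" for m :: nat
  have sets: "A m k \<in> sets birth_intensity" "A' m \<in> sets birth_intensity" for m k
    unfolding A_def A'_def T_def by (auto intro!: sets_box)
  have T: "1 \<le> T m" for m
    using scale_time_ge(3)[OF C(1), of m] by (simp add: T_def)
  have A: "emeasure birth_intensity (A m k) < \<infinity>"
      "measure birth_intensity (A m k) = p * real C * real (Suc m)" for m k
    using measure_box[of "{real (Suc k)..real (Suc k) + 1}" 1 "real (k * (C * Suc m))"
        "real (Suc k * (C * Suc m))" p] p
    by (auto simp: A_def algebra_simps)
  have A': "emeasure birth_intensity (A' m) < \<infinity>"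
      "measure birth_intensity (A' m) = T m * (2 ^ Suc m * p)" for m
    using measure_box[of "{0..2 ^ Suc m}" "2 ^ Suc m" "T m" "2 * T m" p] p T[of m]
    by (auto simp: A'_def)
  have rv [measurable]: "(\<lambda>\<omega>. emeasure (N \<omega>) S) \<in> borel_measurable M"
    if "S \<in> sets birth_intensity" for S
    using N that unfolding poisson_point_process_def by blast
  define Z where "Z m k = {\<omega> \<in> space M. emeasure (N \<omega>) (A m k) = 0}" for m k
  define Z' where "Z' m = {\<omega> \<in> space M. emeasure (N \<omega>) (A' m) \<le> ennreal (measure birth_intensity (A' m) / 4)}" for m
  define F where "F m = (\<Union>k\<in>{..<2 ^ Suc m}. Z m k) \<union> Z' m" for m
  have Z: "Z m k \<in> events" "Z' m \<in> events" for m k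
    unfolding Z_def Z'_def using rv[OF sets(1)] rv[OF sets(2)] by measurable
  then have F: "F m \<in> events" for m
    unfolding F_def by auto
  have prob: "prob (F m) \<le> (1 / 2) ^ m" for m
  proof -
    have e: "exp (- (p * real C * real (Suc m))) \<le> (1 / 4) ^ Suc m"
    proof -
      have "exp (- (p * real C * real (Suc m))) = exp (- (p * real C)) ^ Suc m"
        by (subst exp_of_nat_mult[symmetric]) (simp add: mult_ac)
      also have "\<dots> \<le> exp (- ln 4) ^ Suc m"
        using C by (intro power_mono) auto
      also have "exp (- ln 4) = (1 / 4 :: real)"
        by (simp add: exp_minus field_simps)
      finally show ?thesis .
    qed
    have "prob (\<Union>k\<in>{..<2 ^ Suc m}. Z m k) \<le> (\<Sum>k<2 ^ Suc m. prob (Z m k))"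
      using Z by (intro finite_measure_subadditive_finite) auto
    also have "\<dots> \<le> (\<Sum>k<(2::nat) ^ Suc m. (1 / 4) ^ Suc m)"
      using e by (intro sum_mono) (simp add: Z_def poisson_eq_0[OF N sets(1) A(1)] A(2))
    also have "\<dots> = (1 / 2) ^ Suc m"
      by (simp add: power_divide power_mult_distrib[symmetric] field_simps)
    finally have 1: "prob (\<Union>k\<in>{..<2 ^ Suc m}. Z m k) \<le> (1 / 2) ^ Suc m" .
    have "prob (Z' m) \<le> exp (- measure birth_intensity (A' m) / 4)"
      unfolding Z'_def by (rule poisson_lower_tail[OF N sets(2) A'(1)])
    also have "\<dots> \<le> exp (- (p * real C * real (Suc m)))"
    proof -
      have "1 * (p * real C * real (Suc m)) \<le> 4 ^ m * (p * real C * real (Suc m))"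
        using p by (intro mult_right_mono) auto
      \<comment> \<open>\<open>T m\<close> contains a factor \<open>2 ^ Suc m\<close>, which
        together with the length \<open>2 ^ Suc m\<close> of the interval gives
        \<open>4 ^ Suc m\<close>; the quarter leaves \<open>4 ^ m\<close>.\<close>
      also have "4 ^ m * (p * real C * real (Suc m)) = measure birth_intensity (A' m) / 4"
        by (simp add: A' T_def scale_time_def power_mult_distrib[symmetric] field_simps)
      finally show ?thesis by simp
    qed
    also note e
    also have "(1 / 4 :: real) ^ Suc m \<le> (1 / 2) ^ Suc m"
      by (intro power_mono) auto
    finally have 2: "prob (Z' m) \<le> (1 / 2) ^ Suc m" .
    have "prob (F m) \<le> prob (\<Union>k\<in>{..<2 ^ Suc m}. Z m k) + prob (Z' m)"
      unfolding F_def using Z by (intro measure_Un_le) auto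
    with 1 2 show ?thesis by simp
  qed
  have "summable (\<lambda>m. prob (F m))"
    by (rule summable_comparison_test'[OF summable_geometric[of "1 / 2 :: real"], of 0])
      (use prob in auto)
  then have "AE \<omega> in M. \<forall>\<^sub>F m in sequentially. \<omega> \<in> space M - F m"
    using F by (intro borel_cantelli_AE1) (auto simp: emeasure_eq_measure)
  then show ?thesis
  proof eventually_elim
    case (elim \<omega>)
    then show ?case
    proof eventually_elim
      case (elim m)
      then have "\<forall>k<2 ^ Suc m. emeasure (N \<omega>) (A m k) \<noteq> 0"
        by (auto simp: F_def Z_def)
      moreover have "ennreal (measure birth_intensity (A' m) / 4) < emeasure (N \<omega>) (A' m)"
        using elim by (auto simp: F_def Z'_def)
      moreover have "measure birth_intensity (A' m) / 4 = p * scale_time C m * 2 ^ Suc m / 4"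
        by (simp add: A' T_def)
      ultimately show ?case
        unfolding A_def A'_def T_def by simp
    qed
  qed
qed

section \<open>Births beyond the linear bound\<close>

text \<open>The null set in \<open>birth_process\<close> may depend on the time; for a fixed
  \<open>B\<close>, the countably many rational times share one.\<close>

lemma birth_process_solves:
  assumes "birth_process M b N \<eta>" "B \<in> sets borel" "bounded B"
  shows "AE \<omega> in M. solves b (N \<omega>) (\<lambda>t. \<eta> t \<omega>) B"
proof -
  have "AE \<omega> in M. \<forall>t\<in>{t\<in>\<rat>. 0 \<le> t}.
      (of_nat (card (\<eta> t \<omega> \<inter> B)) :: ennreal) =
           (\<integral>\<^sup>+ (s, x, u) \<in> {0<..t} \<times> B \<times> {0..}.
              indicator {0..b x (left_limit config_topology (\<lambda>r. \<eta> r \<omega>) s)} u \<partial>N \<omega>)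
           + of_nat (card (\<eta> 0 \<omega> \<inter> B))"
  proof (subst AE_ball_countable)
    show "countable {t\<in>\<rat>. 0 \<le> (t :: real)}"
      using countable_rat by (rule countable_subset[rotated]) auto
  qed (use assms in \<open>auto simp: birth_process_def\<close>)
  then show ?thesis
    unfolding solves_def by eventually_elim blast
qed

lemma (in prob_space) birth_process_exceeds:
  fixes c \<alpha> K\<^sub>0 K\<^sub>1 :: real
  assumes \<alpha>: "0 \<le> \<alpha>" "\<alpha> \<le> 2" and c: "0 < c" and K: "0 < K\<^sub>0" "0 < K\<^sub>1"
    and N: "poisson_point_process M birth_intensity N"
    and \<eta>: "birth_process M (birth_rate (birth_kernel c \<alpha>)) N \<eta>"
    and \<eta>0: "AE \<omega> in M. \<eta> 0 \<omega> = {0}"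
  shows "AE \<omega> in M. \<not> (\<forall>\<^sub>F t in at_top. \<eta> t \<omega> \<subseteq> {- (K\<^sub>0 + K\<^sub>1 * t)..K\<^sub>0 + K\<^sub>1 * t})"
proof -
  define a where "a = birth_kernel c \<alpha>"
  have a: "continuous_on UNIV a" "bounded (range a)" "\<And>z. 0 \<le> a z"
    unfolding a_def using c \<alpha>
    by (auto intro: continuous_birth_kernel bounded_birth_kernel birth_kernel_nonneg)
  \<comment> \<open>Points of neighbouring cells are within distance 2; the cap at 1 respects the
    truncation in \<open>birth_rate\<close>.\<close>
  define p where "p = min 1 (a 2)"
  have "0 < a 2"
    using c by (simp add: a_def birth_kernel_def)
  then have p: "0 < p" "p \<le> 1" by (auto simp: p_def)
  have p': "p \<le> a z" if "\<bar>z\<bar> \<le> 2" for z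
    using birth_kernel_antimono[of c \<alpha> z 2] that c \<alpha> by (simp add: p_def a_def)
  obtain C :: nat where "max 1 (ln 4 / p) \<le> real C"
    using real_arch_simple by blast
  then have C: "0 < C" "ln 4 \<le> p * real C"
    using p by (auto simp: field_simps)
  define T where "T m = real (scale_time C m)" for m
  have T: "1 \<le> T m" "real m \<le> T m" "2 ^ Suc m \<le> T m" "T m \<in> \<rat>" for m
    using scale_time_ge[OF C(1), of m] of_nat_le_iff[of "2 ^ Suc m" "scale_time C m", where 'a = real]
    by (auto simp: T_def simp del: of_nat_le_iff)
  \<comment> \<open>Scale \<open>m\<close> has three phases of length \<open>T m\<close>: occupying
    the cells, accumulating points, and a distant birth. \<open>X m\<close> is the linear bound at
    the end \<open>3 * T m\<close> of the last phase.\<close>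
  define X where "X m = K\<^sub>0 + K\<^sub>1 * (3 * T m)" for m
  have X: "0 < X m" for m
    using K T(1)[of m] by (auto simp: X_def intro!: add_pos_pos mult_pos_pos)
  \<comment> \<open>Chosen so that \<open>2 * X m + T m \<le> R * T m\<close>, as \<open>T m\<close>
    is at least 1. This bounds the distance between \<open>{X m<..2 * X m}\<close> and any point of
    \<open>{0..2 ^ Suc m}\<close>, and \<open>r m\<close> is the resulting lower bound for the
    kernel.\<close>
  define R where "R = 2 * K\<^sub>0 + 6 * K\<^sub>1 + 1"
  define r where "r m = c / ((1 + R\<^sup>2)\<^sup>2 * T m ^ 4)" for m
  \<comment> \<open>The second entry is the factor of \<open>2 ^ Suc m / T m ^ 3\<close> in
    \<open>n m * r m\<close>, the birth rate guaranteed far away; the cap at 1 ensures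
    \<open>h m \<le> 1\<close>.\<close>
  define \<kappa> where "\<kappa> = min 1 (p * c / (4 * (1 + R\<^sup>2)\<^sup>2))"
  have \<kappa>: "0 < \<kappa>" "\<kappa> \<le> 1"
    using p c by (auto simp: \<kappa>_def add_nonneg_eq_0_iff intro!: divide_pos_pos mult_pos_pos)
  define h where "h m = \<kappa> * 2 ^ Suc m / T m ^ 3" for m
  define n where "n m = p * T m * 2 ^ Suc m / 4" for m
  have h0: "0 \<le> h m" for m
    using \<kappa> T(1)[of m] by (simp add: h_def)
  have h1: "h m \<le> 1" for m
  proof -
    have "\<kappa> * 2 ^ Suc m \<le> 1 * T m"
      using \<kappa> T(1,3)[of m] by (intro mult_mono) auto
    also have "1 * T m \<le> T m ^ 3"
      using T(1)[of m] self_le_power[of "T m" 3] by simp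
    finally show ?thesis
      using T(1)[of m] by (simp add: h_def)
  qed
  have hn: "h m \<le> n m * r m" for m
  proof -
    have "h m \<le> (p * c / (4 * (1 + R\<^sup>2)\<^sup>2)) * 2 ^ Suc m / T m ^ 3"
      unfolding h_def using T(1)[of m]
      by (intro divide_right_mono mult_right_mono) (auto simp: \<kappa>_def)
    also have "\<dots> = n m * r m"
      using T(1)[of m] by (simp add: n_def r_def eval_nat_numeral mult_ac)
    finally show ?thesis .
  qed
  have r: "0 \<le> r m" for m
    using c by (simp add: r_def)
  have ra: "r m \<le> a (x - y)" if "x \<in> {X m<..2 * X m}" "y \<in> {0..2 ^ Suc m}" for x y m
  proof -
    have TT: "(1 + (R * T m)\<^sup>2)\<^sup>2 \<le> (1 + R\<^sup>2)\<^sup>2 * T m ^ 4"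
    proof -
      have "1 + (R * T m)\<^sup>2 \<le> (1 + R\<^sup>2) * (T m)\<^sup>2"
        using T(1)[of m] by (simp add: power_mult_distrib distrib_right one_le_power)
      then have "(1 + (R * T m)\<^sup>2)\<^sup>2 \<le> ((1 + R\<^sup>2) * (T m)\<^sup>2)\<^sup>2"
        by (intro power_mono) auto
      then show ?thesis by (simp add: power_mult_distrib power_mult[symmetric])
    qed
    have "r m \<le> c / (1 + (R * T m)\<^sup>2)\<^sup>2"
      unfolding r_def using c T(1)[of m] TT
      by (intro divide_left_mono mult_pos_pos zero_less_power add_pos_nonneg) auto
    also have "\<dots> \<le> a (R * T m)"
      unfolding a_def using c \<alpha> by (intro birth_kernel_ge) auto
    also have "\<dots> \<le> a (x - y)"
      unfolding a_def
    proof (rule birth_kernel_antimono)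
      have "\<bar>x - y\<bar> \<le> 2 * X m + T m"
        using that X[of m] T(1,3)[of m] by auto
      also have "\<dots> \<le> R * T m"
      proof -
        have "2 * K\<^sub>0 * 1 \<le> 2 * K\<^sub>0 * T m"
          using K T(1)[of m] by (intro mult_left_mono) auto
        then show ?thesis by (simp add: X_def R_def algebra_simps)
      qed
      finally show "\<bar>x - y\<bar> \<le> \<bar>R * T m\<bar>" by linarith
    qed (use c \<alpha> in auto)
    finally show ?thesis .
  qed

  \<comment> \<open>The target interval has length \<open>X m\<close>, itself of order
    \<open>T m\<close>, so the mean of \<open>D m\<close> is of order
    \<open>T m * T m * h m\<close>, that is \<open>2 ^ Suc m / T m\<close>.\<close>
  define D where "D m = {2 * T m<..3 * T m} \<times> ({X m<..2 * X m} \<times> {0..h m})" for m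
  have D: "D m \<in> sets birth_intensity" "emeasure birth_intensity (D m) < \<infinity>"
      "measure birth_intensity (D m) = T m * (X m * h m)" for m
    using measure_box[of "{X m<..2 * X m}" "X m" "2 * T m" "3 * T m" "h m"] T(1)[of m] X[of m] h0[of m]
      sets_box[of "{X m<..2 * X m}" "2 * T m"]
    by (auto simp: D_def)
  have disj: "disjoint_family D"
  proof -
    have "D m \<inter> D m' = {}" if "m < m'" for m m'
    proof -
      have "2 * T m \<le> T m'"
        using scale_time_double[OF that, of C] by (simp add: T_def flip: of_nat_le_iff)
      then have "{2 * T m<..3 * T m} \<inter> {2 * T m'<..3 * T m'} = {}"
        using T(1)[of m] by auto
      then show ?thesis by (auto simp: D_def)
    qed
    then show ?thesis
      unfolding disjoint_family_on_def by (metis Int_commute linorder_neqE_nat)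
  qed
  have div: "\<not> summable (\<lambda>m. measure birth_intensity (D m))"
  proof
    assume "summable (\<lambda>m. measure birth_intensity (D m))"
    then have "summable (\<lambda>m. (C / (3 * K\<^sub>1 * \<kappa>)) * measure birth_intensity (D m))"
      by (rule summable_mult)
    \<comment> \<open>Replacing \<open>X m\<close> by the smaller \<open>3 * K\<^sub>1 * T m\<close>
      leaves exactly the harmonic term, since \<open>2 ^ Suc m / T m\<close> is
      \<open>1 / (C * Suc m)\<close>.\<close>
    moreover have "norm (inverse (real (Suc m))) \<le> (C / (3 * K\<^sub>1 * \<kappa>)) * measure birth_intensity (D m)" for m
    proof -
      have "inverse (real (Suc m)) = (C / (3 * K\<^sub>1 * \<kappa>)) * (T m * ((3 * K\<^sub>1 * T m) * h m))"
      proof -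
        have "T m * ((3 * K\<^sub>1 * T m) * h m) = 3 * K\<^sub>1 * \<kappa> * 2 ^ Suc m / T m"
          using T(1)[of m] by (simp add: h_def eval_nat_numeral)
        also have "\<dots> = (2 ^ Suc m * (3 * K\<^sub>1 * \<kappa>)) / (2 ^ Suc m * (real C * real (Suc m)))"
          by (simp only: T_def scale_time_def of_nat_mult of_nat_power of_nat_numeral mult_ac)
        also have "\<dots> = 3 * K\<^sub>1 * \<kappa> / (real C * real (Suc m))"
          by (rule mult_divide_mult_cancel_left) simp
        finally have eq: "T m * ((3 * K\<^sub>1 * T m) * h m) = 3 * K\<^sub>1 * \<kappa> / (real C * real (Suc m))" .
        show ?thesis
          unfolding eq using C K \<kappa> by (simp add: inverse_eq_divide del: of_nat_Suc)
      qed
      also have "\<dots> \<le> (C / (3 * K\<^sub>1 * \<kappa>)) * (T m * (X m * h m))"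
        using K \<kappa> T(1)[of m] h0[of m]
        by (intro mult_left_mono mult_right_mono) (auto simp: X_def)
      finally have "inverse (real (Suc m)) \<le> (C / (3 * K\<^sub>1 * \<kappa>)) * measure birth_intensity (D m)"
        by (simp only: D)
      then show ?thesis by (simp only: real_norm_def abs_of_nonneg inverse_nonnegative_iff_nonnegative of_nat_0_le_iff)
    qed
    ultimately have "summable (\<lambda>m. inverse (real (Suc m)))"
      by (rule summable_comparison_test'[where N = 0])
    then show False
      using not_summable_harmonic[where 'a = real] summable_Suc_iff[of "\<lambda>m. inverse (real m)"] by blast
  qed

  have "AE \<omega> in M. \<exists>\<^sub>\<infinity>m. emeasure (N \<omega>) (D m) \<noteq> 0"
    by (rule poisson_infinitely_often[OF N D(1,2) disj div])
  moreover note poisson_scales_good[OF N p(1) C]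
  moreover have "AE \<omega> in M. \<forall>k::nat. solves (birth_rate a) (N \<omega>) (\<lambda>t. \<eta> t \<omega>) {real k..real k + 1}"
    unfolding AE_all_countable a_def by (intro allI birth_process_solves[OF \<eta>]) auto
  moreover have "AE \<omega> in M. \<forall>k::nat. solves (birth_rate a) (N \<omega>) (\<lambda>t. \<eta> t \<omega>) {0..real k}"
    unfolding AE_all_countable a_def by (intro allI birth_process_solves[OF \<eta>]) auto
  moreover have "AE \<omega> in M. \<forall>m. solves (birth_rate a) (N \<omega>) (\<lambda>t. \<eta> t \<omega>) {X m<..2 * X m}"
    unfolding AE_all_countable a_def by (intro allI birth_process_solves[OF \<eta>]) auto
  ultimately show ?thesis
    using \<eta>0 AE_space
  proof eventually_elim
    case (elim \<omega>)
    define f where "f t = \<eta> t \<omega>" for t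
    have cad: "cadlag config_topology f"
      using \<eta> elim(7) unfolding f_def birth_process_def by blast
    have \<nu>: "sets (N \<omega>) = sets birth_intensity"
      using N elim(7) unfolding poisson_point_process_def by blast
    have f0: "f 0 = {0}" using elim(6) by (simp add: f_def)
    note sol1 = elim(3)[folded f_def, rule_format]
    note sol2 = elim(4)[folded f_def, rule_format]
    note sol3 = elim(5)[folded f_def, rule_format]
    have far: "\<forall>\<^sub>F m in sequentially. emeasure (N \<omega>) (D m) \<noteq> 0 \<longrightarrow> f (3 * T m) \<inter> {X m<..2 * X m} \<noteq> {}"
      using elim(2)
    proof eventually_elim
      case (elim m)
      \<comment> \<open>First phase: the last cell is occupied by time
        \<open>2 ^ Suc m * (C * Suc m)\<close>, which is \<open>T m\<close>.\<close>
      have occ: "f (real (k * (C * Suc m))) \<inter> {real k..real k + 1} \<noteq> {}" if "k \<le> 2 ^ Suc m" for k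
        by (rule cells_occupied[OF cad sol1 a less_imp_le[OF p(1)] p(2) p' \<nu> f0 _ that])
          (assumption, rule elim[THEN conjunct1, rule_format])
      have "ennreal (n m) < emeasure (N \<omega>) ({T m<..2 * T m} \<times> ({0..real (2 ^ Suc m)} \<times> {0..p}))"
        using elim[THEN conjunct2] by (simp add: n_def T_def)
      also have "\<dots> \<le> of_nat (card (f (2 * T m) \<inter> {0..real (2 ^ Suc m)}))"
        by (rule cells_mass[OF cad sol1 sol2 a less_imp_le[OF p(1)] p(2) p' \<nu> occ])
          (use T(1,4)[of m] in \<open>simp_all add: T_def scale_time_def\<close>)
      finally have card: "n m \<le> real (card (f (2 * T m) \<inter> {0..real (2 ^ Suc m)}))"
        by (simp add: ennreal_of_nat_eq_real_of_nat ennreal_less_iff n_def T_def p less_imp_le)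
      show ?case
      proof
        assume hit: "emeasure (N \<omega>) (D m) \<noteq> 0"
        show "f (3 * T m) \<inter> {X m<..2 * X m} \<noteq> {}"
          by (rule birth_far_away[OF cad sol2 sol3 a \<nu> _ _ _ _ _ card r _ h1 hn hit[unfolded D_def]])
            (use T(1,4)[of m] ra[of _ m] in auto)
      qed
    qed
    show ?case
    proof
      assume "\<forall>\<^sub>F t in at_top. \<eta> t \<omega> \<subseteq> {- (K\<^sub>0 + K\<^sub>1 * t)..K\<^sub>0 + K\<^sub>1 * t}"
      then obtain t0 where t0: "\<And>t. t0 \<le> t \<Longrightarrow> f t \<subseteq> {- (K\<^sub>0 + K\<^sub>1 * t)..K\<^sub>0 + K\<^sub>1 * t}"
        by (auto simp: eventually_at_top_linorder f_def)
      obtain m0 where m0: "\<And>m. m0 \<le> m \<Longrightarrow> emeasure (N \<omega>) (D m) \<noteq> 0 \<Longrightarrow> f (3 * T m) \<inter> {X m<..2 * X m} \<noteq> {}"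
        using far by (auto simp: eventually_sequentially)
      \<comment> \<open>As \<open>m\<close> is at least \<open>t0\<close> and
        \<open>real m \<le> T m\<close>, the time \<open>3 * T m\<close> of the distant point is
        past \<open>t0\<close>.\<close>
      obtain m where m: "max m0 (nat \<lceil>t0\<rceil>) \<le> m" "emeasure (N \<omega>) (D m) \<noteq> 0"
        using elim(1) unfolding INFM_nat_le by blast
      then obtain x where x: "x \<in> f (3 * T m)" "X m < x"
        using m0[of m] by auto
      have "t0 \<le> real m" using m(1) by linarith
      then have "t0 \<le> 3 * T m" using T(1,2)[of m] by linarith
      from t0[OF this] x show False by (auto simp: X_def)
    qed
  qed
qed

theorem theorem2p7:
  fixes M :: "'a measure"
    and N :: "'a \<Rightarrow> (real \<times> real \<times> real) measure"
    and \<eta> :: "real \<Rightarrow> 'a \<Rightarrow> real set"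
    and \<alpha> c :: real
  assumes "prob_space M"
    and "1 / 2 < \<alpha>" and "\<alpha> \<le> 2"
    and "c > 0" and "has_bochner_integral lborel (birth_kernel c \<alpha>) 1"
    and "poisson_point_process M birth_intensity N"
    and "birth_process M (birth_rate (birth_kernel c \<alpha>)) N \<eta>"
    and "AE \<omega> in M. \<eta> 0 \<omega> = {0}"
  shows "\<forall>K\<^sub>0>0. \<forall>K\<^sub>1>0.
    {\<omega> \<in> space M. \<forall>\<^sub>F t in at_top. \<eta> t \<omega> \<subseteq> {- K\<^sub>0 - K\<^sub>1 * t..K\<^sub>0 + K\<^sub>1 * t}} \<in> sets M \<and>
    measure M {\<omega> \<in> space M. \<forall>\<^sub>F t in at_top. \<eta> t \<omega> \<subseteq> {- K\<^sub>0 - K\<^sub>1 * t..K\<^sub>0 + K\<^sub>1 * t}} = 0"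
proof (intro allI impI)
  fix K\<^sub>0 K\<^sub>1 :: real assume K: "0 < K\<^sub>0" "0 < K\<^sub>1"
  interpret prob_space M by fact
  define E where "E = {\<omega> \<in> space M. \<forall>\<^sub>F t in at_top. \<eta> t \<omega> \<subseteq> {- K\<^sub>0 - K\<^sub>1 * t..K\<^sub>0 + K\<^sub>1 * t}}"
  \<comment> \<open>This is the symmetric form \<open>{- L t..L t}\<close> that
    \<open>sets_eventually_subset\<close> expects.\<close>
  have E_eq: "E = {\<omega> \<in> space M. \<forall>\<^sub>F t in at_top. \<eta> t \<omega> \<subseteq> {- (K\<^sub>0 + K\<^sub>1 * t)..K\<^sub>0 + K\<^sub>1 * t}}"
    by (simp add: E_def)
  have E: "E \<in> events"
    unfolding E_eq using assms(7)
    by (intro sets_eventually_subset) (auto simp: birth_process_def intro!: continuous_intros)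
  have "AE \<omega> in M. \<omega> \<notin> E"
    using birth_process_exceeds[OF _ assms(3,4) K assms(6,7,8)] assms(2)
    by (auto simp: E_eq elim: AE_mp)
  with E have "prob E = 0"
    by (simp add: prob_eq_0)
  with E show "E \<in> events \<and> prob E = 0" ..
qed

end
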